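(* Let $X$ be a complex Hilbert space and let $T\in\mathcal{B}(X)$. Suppose that the closure $\Omega$ of the numerical range $W(T)$ of $T$ is contained in the closed unit disc and that there exist constants $C>0$ and $\beta\in(0,1]$ such that $$\sup\{|\lambda^n(1-\lambda)|:\lambda\in\Omega\}\le Cn^{-\beta},\quad n\ge1.$$ Then $T$ is power-bounded, $\sigma(T)\cap\mathbb{T}\subseteq\{1\}$, and $$\|R(e^{i\theta},T)\|=O(|\theta|^{-1/\beta}),\quad\theta\to0.$$
   Context: $\mathcal{B}(X)$ is the algebra of bounded linear operators on $X$. The numerical range of $T$ is $W(T)=\{(Tx,x):x\in X,\ \|x\|=1\}$. $T$ is power-bounded if $\sup_{n\ge1}\|T^n\|<\infty$. $\sigma(T)$ is the spectrum of $T$, $R(\lambda,T)=(\lambda I-T)^{-1}$ for $\lambda\notin\sigma(T)$, and $\mathbb{T}=\{\lambda\in\mathbb{C}:|\lambda|=1\}$. *)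

theory Defs
  imports "HOL-Analysis.Analysis"
begin

class complex_vector = real_vector +
  fixes scaleC :: "complex \<Rightarrow> 'a \<Rightarrow> 'a"  (infixr \<open>*\<^sub>C\<close> 75)
  assumes scaleC_add_right: "a *\<^sub>C (x + y) = a *\<^sub>C x + a *\<^sub>C y"
    and scaleC_add_left: "(a + b) *\<^sub>C x = a *\<^sub>C x + b *\<^sub>C x"
    and scaleC_scaleC: "a *\<^sub>C (b *\<^sub>C x) = (a * b) *\<^sub>C x"
    and scaleC_one: "1 *\<^sub>C x = x"
    and scaleR_scaleC: "r *\<^sub>R x = complex_of_real r *\<^sub>C x"

text \<open>The inner product is linear in its first argument.\<close>

class complex_inner = complex_vector + real_normed_vector +
  fixes cinner :: "'a \<Rightarrow> 'a \<Rightarrow> complex"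
  assumes cinner_commute: "cinner x y = cnj (cinner y x)"
    and cinner_add_left: "cinner (x + y) z = cinner x z + cinner y z"
    and cinner_scaleC_left: "cinner (a *\<^sub>C x) y = a * cinner x y"
    and cinner_ge_zero: "0 \<le> Re (cinner x x)"
    and cinner_eq_zero_iff: "cinner x x = 0 \<longleftrightarrow> x = 0"
    and norm_eq_sqrt_cinner: "norm x = sqrt (Re (cinner x x))"

class complex_hilbert_space = complex_inner + complete_space

definition bounded_clinear :: "('a::complex_inner \<Rightarrow> 'a) \<Rightarrow> bool" where
  "bounded_clinear T \<longleftrightarrow> bounded_linear T \<and> (\<forall>c x. T (c *\<^sub>C x) = c *\<^sub>C T x)"

definition numerical_range :: "('a::complex_inner \<Rightarrow> 'a) \<Rightarrow> complex set" where
  "numerical_range T = {cinner (T x) x | x. norm x = 1}"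

definition power_bounded :: "('a::complex_inner \<Rightarrow> 'a) \<Rightarrow> bool" where
  "power_bounded T \<longleftrightarrow> bdd_above ((\<lambda>n. onorm (T ^^ n)) ` {1..})"

definition spectrum :: "('a::complex_inner \<Rightarrow> 'a) \<Rightarrow> complex set" where
  "spectrum T = {l. \<not> (\<exists>S. bounded_clinear S \<and>
     S \<circ> (\<lambda>x. l *\<^sub>C x - T x) = id \<and> (\<lambda>x. l *\<^sub>C x - T x) \<circ> S = id)}"

text \<open>Only meaningful for \<open>l\<close> outside the spectrum of \<open>T\<close>, where the function being
  inverted is a bijection.\<close>

definition resolvent :: "complex \<Rightarrow> ('a::complex_inner \<Rightarrow> 'a) \<Rightarrow> 'a \<Rightarrow> 'a" where
  "resolvent l T = inv (\<lambda>x. l *\<^sub>C x - T x)"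

end

theory Submission
  imports Defs
begin

text \<open>Berger's inequality for the numerical radius gives \<open>\<bar>(T^n x, x)\<bar> \<le> \<parallel>x\<parallel>^2\<close>, hence
  \<open>\<parallel>T^n\<parallel> \<le> 2\<close>. For \<open>\<bar>l\<bar> = 1\<close> outside \<open>\<Omega>\<close> one has \<open>\<parallel>(l - T) x\<parallel> \<ge> dist(l, \<Omega>) \<parallel>x\<parallel>\<close>, and
  \<open>l - T\<close> is onto, so \<open>\<parallel>R(l, T)\<parallel> \<le> 1 / dist(l, \<Omega>)\<close>. The decay hypothesis forces
  \<open>dist(exp(i \<theta>), \<Omega>) \<ge> K \<bar>\<theta>\<bar> powr (1 / \<beta>)\<close> for small \<open>\<theta>\<close>.\<close>

section \<open>Complex inner products\<close>

lemma cinner_add_right: "cinner x (y + z) = cinner x y + cinner x z"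
  by (metis cinner_commute cinner_add_left complex_cnj_add)

lemma cinner_scaleC_right: "cinner x (a *\<^sub>C y) = cnj a * cinner x y"
  by (metis cinner_commute cinner_scaleC_left complex_cnj_mult)

lemma scaleC_minus1: "(-1) *\<^sub>C x = - (x::'a::complex_vector)"
  using scaleR_scaleC[of "-1" x] by simp

lemma scaleC_zero_left [simp]: "0 *\<^sub>C x = (0::'a::complex_vector)"
  using scaleR_scaleC[of 0 x] by simp

lemma scaleC_zero_right [simp]: "a *\<^sub>C 0 = (0::'a::complex_vector)"
  using scaleC_add_right[of a 0 0] by simp

lemma scaleC_minus_right: "a *\<^sub>C (- x) = - (a *\<^sub>C (x::'a::complex_vector))"
  using scaleC_add_right[of a x "-x"] by (simp add: eq_neg_iff_add_eq_0 add.commute)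

lemma scaleC_minus_left: "(- a) *\<^sub>C x = - (a *\<^sub>C (x::'a::complex_vector))"
  using scaleC_add_left[of a "-a" x] by (simp add: eq_neg_iff_add_eq_0 add.commute)

lemma scaleC_diff_right: "a *\<^sub>C (x - y) = a *\<^sub>C x - a *\<^sub>C (y::'a::complex_vector)"
  using scaleC_add_right[of a x "-y"] by (simp add: scaleC_minus_right)

lemma scaleC_diff_left: "(a - b) *\<^sub>C x = a *\<^sub>C x - b *\<^sub>C (x::'a::complex_vector)"
  using scaleC_add_left[of a "-b" x] by (simp add: scaleC_minus_left)

lemma scaleC_sum_right: "a *\<^sub>C (\<Sum>i\<in>A. f i) = (\<Sum>i\<in>A. a *\<^sub>C (f i :: 'a::complex_vector))"
  by (induction A rule: infinite_finite_induct) (auto simp: scaleC_add_right)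

lemma scaleC_sum_left: "(\<Sum>i\<in>A. f i) *\<^sub>C x = (\<Sum>i\<in>A. f i *\<^sub>C (x :: 'a::complex_vector))"
  by (induction A rule: infinite_finite_induct) (auto simp: scaleC_add_left)

lemma cinner_minus_left: "cinner (- x) y = - cinner x y"
  using cinner_scaleC_left[of "-1" x y] by (simp add: scaleC_minus1)

lemma cinner_minus_right: "cinner x (- y) = - cinner x y"
  using cinner_scaleC_right[of x "-1" y] by (simp add: scaleC_minus1)

lemma cinner_diff_left: "cinner (x - y) z = cinner x z - cinner y z"
  using cinner_add_left[of x "-y" z] by (simp add: cinner_minus_left)

lemma cinner_diff_right: "cinner x (y - z) = cinner x y - cinner x z"
  using cinner_add_right[of x y "-z"] by (simp add: cinner_minus_right)

lemma cinner_zero_left [simp]: "cinner 0 x = 0"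
  using cinner_scaleC_left[of 0 0 x] by simp

lemma cinner_zero_right [simp]: "cinner x 0 = 0"
  using cinner_scaleC_right[of x 0 0] by simp

lemma cinner_sum_right: "cinner x (\<Sum>i\<in>A. f i) = (\<Sum>i\<in>A. cinner x (f i))"
  by (induction A rule: infinite_finite_induct) (auto simp: cinner_add_right)

lemma cinner_self: "cinner x x = complex_of_real ((norm x)\<^sup>2)"
proof -
  have "Im (cinner x x) = 0"
    using cinner_commute[of x x] by (metis Reals_cnj_iff complex_is_Real_iff)
  moreover have "Re (cinner x x) = (norm x)\<^sup>2"
    by (simp add: norm_eq_sqrt_cinner cinner_ge_zero)
  ultimately show ?thesis
    by (simp add: complex_eq_iff)
qed

lemma norm_scaleC: "norm (a *\<^sub>C x) = cmod a * norm (x::'a::complex_inner)"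
proof -
  have "complex_of_real ((norm (a *\<^sub>C x))\<^sup>2) = complex_of_real ((cmod a * norm x)\<^sup>2)"
    unfolding power_mult_distrib of_real_mult complex_norm_square cinner_self[symmetric]
      cinner_scaleC_left cinner_scaleC_right by (simp only: mult_ac)
  then have "(norm (a *\<^sub>C x))\<^sup>2 = (cmod a * norm x)\<^sup>2"
    using of_real_eq_iff by blast
  then show ?thesis
    by (simp add: power2_eq_iff_nonneg)
qed

text \<open>The parallelogram law. It controls the two quadratic forms that polarization
  produces.\<close>

lemma norm_add_diff_cinner:
  "(norm (x + y))\<^sup>2 + (norm (x - y))\<^sup>2 = 2 * ((norm x)\<^sup>2 + (norm (y::'a::complex_inner))\<^sup>2)"
proof -
  have "complex_of_real ((norm (x + y))\<^sup>2 + (norm (x - y))\<^sup>2)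
      = complex_of_real (2 * ((norm x)\<^sup>2 + (norm y)\<^sup>2))"
    unfolding of_real_add of_real_mult cinner_self[symmetric]
    by (simp add: cinner_add_left cinner_add_right cinner_diff_left cinner_diff_right)
  then show ?thesis
    using of_real_eq_iff by blast
qed

lemma cmod_cinner_le: "cmod (cinner x y) \<le> norm x * norm y"
proof (cases "y = 0")
  case False
  \<comment> \<open>\<open>c *\<^sub>C y\<close> is the orthogonal projection of \<open>x\<close>
    onto the line of \<open>y\<close>; Cauchy-Schwarz says that the remainder has nonnegative
    squared norm.\<close>
  define c where "c = cinner x y / cinner y y"
  have y: "cinner y y \<noteq> 0"
    using False by (simp add: cinner_eq_zero_iff)
  have "cinner (x - c *\<^sub>C y) (x - c *\<^sub>C y)
      = cinner x x - cinner x y * cnj (cinner x y) / cinner y y"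
    unfolding cinner_diff_left cinner_diff_right cinner_scaleC_left cinner_scaleC_right
    using y cinner_commute[of y x] cinner_commute[of y y]
    by (simp add: c_def field_simps)
  then have "complex_of_real ((norm (x - c *\<^sub>C y))\<^sup>2)
      = complex_of_real ((norm x)\<^sup>2 - (cmod (cinner x y))\<^sup>2 / (norm y)\<^sup>2)"
    by (simp add: cinner_self complex_norm_square[symmetric])
  then have "(norm (x - c *\<^sub>C y))\<^sup>2 = (norm x)\<^sup>2 - (cmod (cinner x y))\<^sup>2 / (norm y)\<^sup>2"
    using of_real_eq_iff by blast
  then have "(cmod (cinner x y))\<^sup>2 / (norm y)\<^sup>2 \<le> (norm x)\<^sup>2"
    by (metis diff_ge_0_iff_ge zero_le_power2)
  then have "(cmod (cinner x y))\<^sup>2 \<le> (norm x * norm y)\<^sup>2"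
    using False by (simp add: field_simps power_mult_distrib)
  then show ?thesis
    by (rule power2_le_imp_le) simp
qed simp

section \<open>Powers of operators with numerical range in the unit disc\<close>

text \<open>Normalizing \<open>x\<close> rescales the quadratic form by the squared norm, so that
  facts about unit vectors reach every nonzero vector.\<close>

lemma numerical_range_quadratic_form:
  assumes "bounded_clinear T" "x \<noteq> 0"
  obtains w where "w \<in> numerical_range T" "cinner (T x) x = w * complex_of_real ((norm x)\<^sup>2)"
proof -
  define u where "u = complex_of_real (1 / norm x) *\<^sub>C x"
  have "norm u = 1"
    using assms(2) by (simp add: u_def norm_scaleC norm_divide)
  moreover have "x = complex_of_real (norm x) *\<^sub>C u"
    using assms(2) by (simp add: u_def scaleC_scaleC scaleC_one)
  then have "cinner (T x) x = cinner (T u) u * complex_of_real ((norm x)\<^sup>2)"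
    using assms(1) unfolding bounded_clinear_def
    by (metis (no_types, lifting) cinner_scaleC_left cinner_scaleC_right complex_cnj_complex_of_real
        mult.assoc mult.commute of_real_mult power2_eq_square)
  ultimately show ?thesis
    using that unfolding numerical_range_def by blast
qed

lemma cmod_quadratic_form_le:
  assumes "bounded_clinear T" "numerical_range T \<subseteq> cball 0 1"
  shows "cmod (cinner (T x) x) \<le> (norm x)\<^sup>2"
proof (cases "x = 0")
  case False
  obtain w where w: "w \<in> numerical_range T"
      "cinner (T x) x = w * complex_of_real ((norm x)\<^sup>2)"
    using numerical_range_quadratic_form[OF assms(1) False] .
  have "cmod w \<le> 1"
    using w(1) assms(2) by auto
  then show ?thesis
    unfolding w(2) norm_mult norm_of_real by (simp add: mult_left_le_one_le)
qed simp

text \<open>The polarization identity costs a factor 2 when passing from the numerical radius to the norm.\<close>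

lemma norm_le_of_quadratic_form:
  assumes T: "bounded_clinear T" and q: "\<And>x. cmod (cinner (T x) x) \<le> (norm x)\<^sup>2"
  shows "norm (T x) \<le> 2 * norm x"
proof -
  have lin: "T (u + v) = T u + T v" "T (u - v) = T u - T v" "T (c *\<^sub>C u) = c *\<^sub>C T u" for u v c
    using T unfolding bounded_clinear_def
    by (auto simp: linear_simps(1,2))
  have half: "cmod (2 * (cinner (T x) y + cinner (T y) x)) \<le> 2 * ((norm x)\<^sup>2 + (norm y)\<^sup>2)" for x y
  proof -
    have "2 * (cinner (T x) y + cinner (T y) x)
        = cinner (T (x + y)) (x + y) - cinner (T (x - y)) (x - y)"
      by (simp add: lin cinner_add_left cinner_add_right cinner_diff_left cinner_diff_right)
    also have "cmod \<dots> \<le> (norm (x + y))\<^sup>2 + (norm (x - y))\<^sup>2"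
      by (intro order_trans[OF norm_triangle_ineq4] add_mono q)
    finally show ?thesis
      by (simp only: norm_add_diff_cinner)
  qed
  have bound: "cmod (cinner (T x) y) \<le> (norm x)\<^sup>2 + (norm y)\<^sup>2" for x y
  proof -
    have 1: "cmod (cinner (T x) y + cinner (T y) x) \<le> (norm x)\<^sup>2 + (norm y)\<^sup>2"
      using half[of x y] by (simp only: norm_mult) simp
    \<comment> \<open>The form is conjugate-linear in its second argument, so replacing
      \<open>y\<close> by \<open>\<i> *\<^sub>C y\<close> turns the sum in \<open>half\<close> into
      a difference. Adding both bounds isolates \<open>cinner (T x) y\<close>.\<close>
    have "cmod (2 * (cinner (T x) (\<i> *\<^sub>C y) + cinner (T (\<i> *\<^sub>C y)) x))
        \<le> 2 * ((norm x)\<^sup>2 + (norm y)\<^sup>2)"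
      using half[of x "\<i> *\<^sub>C y"] by (simp add: norm_scaleC)
    moreover have "2 * (cinner (T x) (\<i> *\<^sub>C y) + cinner (T (\<i> *\<^sub>C y)) x)
        = - 2 * \<i> * (cinner (T x) y - cinner (T y) x)"
      by (simp add: lin cinner_scaleC_left cinner_scaleC_right algebra_simps)
    ultimately have 2: "cmod (cinner (T x) y - cinner (T y) x) \<le> (norm x)\<^sup>2 + (norm y)\<^sup>2"
      by (simp add: norm_mult)
    have "2 * cinner (T x) y
        = (cinner (T x) y + cinner (T y) x) + (cinner (T x) y - cinner (T y) x)"
      by simp
    then have "cmod (2 * cinner (T x) y) \<le> 2 * ((norm x)\<^sup>2 + (norm y)\<^sup>2)"
      using norm_triangle_mono[OF 1 2] by simp
    then show ?thesis
      by (simp only: norm_mult) simp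
  qed
  show ?thesis
  proof (cases "T x = 0")
    case False
    \<comment> \<open>This scales \<open>T x\<close> to the length of \<open>x\<close>, which
      balances the two squares in \<open>bound\<close>.\<close>
    define r where "r = norm x / norm (T x)"
    have "cmod (cinner (T x) (complex_of_real r *\<^sub>C T x)) = r * (norm (T x))\<^sup>2"
      by (simp add: cinner_scaleC_right cinner_self norm_mult r_def norm_power norm_divide)
    also have "\<dots> = norm x * norm (T x)"
      using False by (simp add: r_def power2_eq_square)
    finally have "norm x * norm (T x) \<le> (norm x)\<^sup>2 + (norm (complex_of_real r *\<^sub>C T x))\<^sup>2"
      using bound by metis
    moreover have "norm (complex_of_real r *\<^sub>C T x) = norm x"
      using False by (simp add: norm_scaleC r_def norm_divide)
    ultimately have "norm x * norm (T x) \<le> norm x * (2 * norm x)"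
      by (simp add: power2_eq_square)
    moreover have "x \<noteq> 0"
      using False lin(2)[of 0 0] by auto
    ultimately show ?thesis
      by simp
  qed simp
qed

text \<open>For \<open>0 < m < n\<close> this is a full geometric sum whose ratio is an
  \<open>n\<close>-th root of unity other than 1. In the averaging below only the term
  \<open>m = 0\<close> survives.\<close>

lemma sum_root_of_unity_powers:
  assumes "m < n"
  shows "(\<Sum>j<n. (cis (2 * pi / real n) ^ j) ^ m) = (if m = 0 then of_nat n else 0)"
proof (cases "m = 0")
  case False
  define w where "w = cis (2 * pi / real n) ^ m"
  have n: "n > 0" using assms by simp
  have w_eq: "w = cis (2 * pi * real m / real n)"
    by (simp add: w_def Complex.DeMoivre mult_ac)
  have "w \<noteq> 1"
  proof
    assume "w = 1"
    then have "cis (2 * pi * real m / real n) = cis (2 * pi * real 0 / real n)"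
      by (simp add: w_eq)
    then have "m = 0"
      by (rule inj_onD[OF bij_betw_imp_inj_on[OF Complex.bij_betw_roots_unity[OF n]]])
        (use assms n in auto)
    with False show False ..
  qed
  moreover have "w ^ n = 1"
    using n by (simp add: w_eq Complex.DeMoivre)
  ultimately have "(\<Sum>j<n. w ^ j) = 0"
    by (simp add: geometric_sum)
  then show ?thesis
    using False by (simp add: w_def power_mult[symmetric] mult.commute)
qed simp

lemma bounded_clinear_funpow:
  assumes "bounded_clinear T"
  shows "bounded_clinear (T ^^ n)"
proof (induction n)
  case 0
  then show ?case
    by (simp add: bounded_clinear_def bounded_linear_ident id_def)
next
  case (Suc n)
  then show ?case
    using assms unfolding bounded_clinear_def
    by (auto simp: o_def intro!: bounded_linear_compose[of T])
qed

text \<open>Pearcy's proof of Berger's inequality. With \<open>w j = \<mu> \<omega>^j\<close>, where \<open>\<omega>\<close> is a primitive \<open>n\<close>-th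
  root of unity, put \<open>y j = (\<Sum>m<n. (w j)^m T^m x)\<close>. The telescoping identity
  \<open>y j - w j T (y j) = x - \<mu>^n T^n x\<close> has the same right-hand side for all \<open>j\<close>, while the
  vectors \<open>y j\<close> sum to \<open>n x\<close>.\<close>

lemma cmod_quadratic_form_funpow_le:
  assumes T: "bounded_clinear T" and q: "\<And>x. cmod (cinner (T x) x) \<le> (norm x)\<^sup>2"
    and n: "n > 0"
  shows "cmod (cinner ((T ^^ n) x) x) \<le> (norm x)\<^sup>2"
proof -
  define c where "c = cinner ((T ^^ n) x) x"
  \<comment> \<open>The phase is chosen so that \<open>\<mu> ^ n * c = cmod c\<close>; a bound on a
    real part then becomes a bound on the modulus of \<open>c\<close>.\<close>
  define \<mu> where "\<mu> = cis (- Arg c / real n)"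
  define w where "w j = \<mu> * cis (2 * pi / real n) ^ j" for j
  define y where "y j = (\<Sum>m<n. w j ^ m *\<^sub>C (T ^^ m) x)" for j
  define v where "v = x - (\<mu> ^ n) *\<^sub>C (T ^^ n) x"
  have norm_w: "cmod (w j) = 1" for j
    by (simp add: w_def \<mu>_def norm_mult norm_power)
  have w_n: "w j ^ n = \<mu> ^ n" for j
  proof -
    have "(cis (2 * pi / real n) ^ j) ^ n = cis (2 * pi * real j)"
      using n by (simp add: Complex.DeMoivre mult_ac)
    also have "\<dots> = 1"
      by simp
    finally show ?thesis
      by (simp add: w_def power_mult_distrib)
  qed
  have T_y: "y j - w j *\<^sub>C T (y j) = v" for j
  proof -
    have "T (y j) = (\<Sum>m<n. w j ^ m *\<^sub>C (T ^^ Suc m) x)"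
      using T unfolding bounded_clinear_def y_def
      by (simp add: bounded_linear.linear linear_sum)
    then have "y j - w j *\<^sub>C T (y j)
        = (\<Sum>m<n. w j ^ m *\<^sub>C (T ^^ m) x - w j ^ Suc m *\<^sub>C (T ^^ Suc m) x)"
      by (simp add: y_def scaleC_sum_right scaleC_scaleC sum_subtractf)
    also have "\<dots> = x - w j ^ n *\<^sub>C (T ^^ n) x"
      by (subst sum_lessThan_telescope') (simp add: scaleC_one)
    finally show ?thesis
      by (simp add: v_def w_n)
  qed
  have sum_y: "(\<Sum>j<n. y j) = of_nat n *\<^sub>C x"
  proof -
    have "(\<Sum>j<n. y j) = (\<Sum>m<n. (\<Sum>j<n. w j ^ m) *\<^sub>C (T ^^ m) x)"
      unfolding y_def scaleC_sum_left by (rule sum.swap)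
    also have "\<dots> = (\<Sum>m<n. (if m = 0 then of_nat n *\<^sub>C x else 0))"
    proof (rule sum.cong[OF refl])
      fix m assume "m \<in> {..<n}"
      then have "(\<Sum>j<n. w j ^ m) = \<mu> ^ m * (if m = 0 then of_nat n else 0)"
        by (simp add: w_def power_mult_distrib sum_distrib_left[symmetric] sum_root_of_unity_powers)
      then show "(\<Sum>j<n. w j ^ m) *\<^sub>C (T ^^ m) x = (if m = 0 then of_nat n *\<^sub>C x else 0)"
        by simp
    qed
    finally show ?thesis
      using n by simp
  qed
  \<comment> \<open>Writing \<open>v\<close> as \<open>y j - w j *\<^sub>C T (y j)\<close> leaves
    the squared norm of \<open>y j\<close> minus a term that \<open>q\<close> bounds by the same
    quantity.\<close>
  have "0 \<le> Re (cinner v (y j))" for j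
  proof -
    have "Re (w j * cinner (T (y j)) (y j)) \<le> cmod (w j * cinner (T (y j)) (y j))"
      by (rule complex_Re_le_cmod)
    also have "\<dots> \<le> (norm (y j))\<^sup>2"
      using q[of "y j"] by (simp add: norm_mult norm_w)
    finally show ?thesis
      unfolding T_y[of j, symmetric]
      by (simp add: cinner_diff_left cinner_scaleC_left cinner_self)
  qed
  \<comment> \<open>Since \<open>v\<close> does not depend on \<open>j\<close>, summation replaces
    the vectors \<open>y j\<close> by a positive multiple of \<open>x\<close>.\<close>
  then have "0 \<le> Re (\<Sum>j<n. cinner v (y j))"
    by (simp add: sum_nonneg)
  also have "\<dots> = real n * Re (cinner v x)"
    by (simp add: cinner_sum_right[symmetric] sum_y cinner_scaleC_right)
  finally have "0 \<le> Re (cinner v x)"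
    using n by (simp add: zero_le_mult_iff)
  moreover have "\<mu> ^ n * c = complex_of_real (cmod c)"
  proof -
    have "\<mu> ^ n = cis (- Arg c)"
      using n by (simp add: \<mu>_def Complex.DeMoivre)
    moreover have "c = complex_of_real (cmod c) * cis (Arg c)"
      using rcis_cmod_Arg[of c] by (simp add: rcis_def)
    ultimately show ?thesis
      by (metis (no_types, lifting) add.left_inverse cis_mult cis_zero mult.left_commute mult.right_neutral)
  qed
  ultimately show ?thesis
    by (simp add: v_def cinner_diff_left cinner_scaleC_left cinner_self c_def[symmetric])
qed

lemma power_bounded_of_numerical_range:
  assumes "bounded_clinear T" "numerical_range T \<subseteq> cball 0 1"
  shows "power_bounded T"
  unfolding power_bounded_def
proof (rule bdd_aboveI)
  fix r assume "r \<in> (\<lambda>n. onorm (T ^^ n)) ` {1..}"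
  then obtain n where "n \<in> {1..}" and r: "r = onorm (T ^^ n)"
    by blast
  then have n: "n > 0"
    by simp
  have "norm ((T ^^ n) x) \<le> 2 * norm x" for x
    using assms n
    by (intro norm_le_of_quadratic_form bounded_clinear_funpow cmod_quadratic_form_funpow_le
        cmod_quadratic_form_le)
  then show "r \<le> 2"
    unfolding r by (intro onorm_bound) auto
qed

section \<open>The resolvent on the unit circle\<close>

text \<open>A right inverse \<open>S\<close> of \<open>A\<close> is Lipschitz with constant
  \<open>1 / d\<close>, so \<open>S (b + B x)\<close> is a contraction in \<open>x\<close> with
  factor \<open>c / d\<close>. Its Banach fixed point solves \<open>A x - B x = b\<close>.\<close>

lemma surj_diff_contraction:
  fixes A B :: "'a::{real_normed_vector, complete_space} \<Rightarrow> 'a"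
  assumes "surj A"
    and A: "\<And>x y. d * norm (x - y) \<le> norm (A x - A y)"
    and B: "\<And>x y. norm (B x - B y) \<le> c * norm (x - y)"
    and "0 \<le> c" "c < d"
  shows "surj (\<lambda>x. A x - B x)"
proof (rule surjI)
  fix b
  define S where "S = inv A"
  have AS: "A (S x) = x" for x
    using assms(1) by (simp add: S_def surj_f_inv_f)
  have "\<exists>!x. S (b + B x) = x"
  proof (rule banach_fix_type[of "c / d"])
    show "\<forall>x y. dist (S (b + B x)) (S (b + B y)) \<le> c / d * dist x y"
    proof (intro allI)
      fix x y
      have "d * norm (S (b + B x) - S (b + B y)) \<le> norm (B x - B y)"
        using A[of "S (b + B x)" "S (b + B y)"] by (simp add: AS)
      also have "\<dots> \<le> c * norm (x - y)"
        by (rule B)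
      finally show "dist (S (b + B x)) (S (b + B y)) \<le> c / d * dist x y"
        using assms(4,5) by (simp add: dist_norm field_simps)
    qed
  qed (use assms(4,5) in auto)
  then obtain x where "S (b + B x) = x"
    by blast
  then have "A x - B x = b"
    using AS[of "b + B x"] by simp
  then show "A (SOME x. A x - B x = b) - B (SOME x. A x - B x = b) = b"
    by (rule someI)
qed

text \<open>Pairing \<open>l *\<^sub>C x - T x\<close> with \<open>x\<close> gives
  \<open>l - w\<close> times the squared norm, for some \<open>w\<close> in the numerical range;
  Cauchy-Schwarz then cancels one factor \<open>norm x\<close>.\<close>

lemma norm_scaleC_diff_ge:
  assumes T: "bounded_clinear T" and d: "\<And>w. w \<in> numerical_range T \<Longrightarrow> d \<le> cmod (l - w)"
  shows "d * norm x \<le> norm (l *\<^sub>C x - T x)"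
proof (cases "x = 0")
  case False
  obtain w where w: "w \<in> numerical_range T"
      "cinner (T x) x = w * complex_of_real ((norm x)\<^sup>2)"
    using numerical_range_quadratic_form[OF T False] .
  have "d * (norm x)\<^sup>2 \<le> cmod (l - w) * (norm x)\<^sup>2"
    by (intro mult_right_mono d w) simp
  also have "\<dots> = cmod ((l - w) * complex_of_real ((norm x)\<^sup>2))"
    by (simp add: norm_mult norm_power)
  also have "(l - w) * complex_of_real ((norm x)\<^sup>2) = cinner (l *\<^sub>C x - T x) x"
    by (simp add: cinner_diff_left cinner_scaleC_left cinner_self w(2) algebra_simps)
  also have "cmod \<dots> \<le> norm (l *\<^sub>C x - T x) * norm x"
    by (rule cmod_cinner_le)
  finally show ?thesis
    using False by (simp add: power2_eq_square mult.assoc[symmetric])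
qed simp

text \<open>The difference of the squares is \<open>(r - 1) * (r + 1 - 2 * Re (l * cnj w))\<close>,
  and both factors are nonnegative. Hence a distance bound at \<open>l\<close> persists outward
  along its ray.\<close>

lemma cmod_diff_radial_mono:
  assumes "cmod l = 1" "cmod w \<le> 1" "1 \<le> r"
  shows "cmod (l - w) \<le> cmod (complex_of_real r * l - w)"
proof -
  have *: "(cmod (complex_of_real s * l - w))\<^sup>2 = s\<^sup>2 - 2 * s * Re (l * cnj w) + (cmod w)\<^sup>2" for s
  proof -
    have "(Re l)\<^sup>2 + (Im l)\<^sup>2 = 1"
      using assms(1) by (simp add: cmod_power2[symmetric])
    then have "s\<^sup>2 = s\<^sup>2 * ((Re l)\<^sup>2 + (Im l)\<^sup>2)"
      by simp
    then show ?thesis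
      unfolding cmod_power2 by (simp add: power2_eq_square algebra_simps)
  qed
  have "Re (l * cnj w) \<le> cmod (l * cnj w)"
    by (rule complex_Re_le_cmod)
  also have "\<dots> \<le> 1"
    using assms by (simp add: norm_mult)
  finally have "0 \<le> (r - 1) * (r + 1 - 2 * Re (l * cnj w))"
    using assms(3) by (intro mult_nonneg_nonneg) auto
  then have "(cmod (l - w))\<^sup>2 \<le> (cmod (complex_of_real r * l - w))\<^sup>2"
    using *[of 1] *[of r] by (simp add: power2_eq_square algebra_simps)
  then show ?thesis
    by (rule power2_le_imp_le) simp
qed

text \<open>Surjectivity is transported along the ray \<open>r l\<close> from large \<open>r\<close> down to \<open>r = 1\<close>, in steps whose
  length is controlled by the lower bound \<open>d\<close>, which is uniform along the ray.\<close>

lemma surj_scaleC_diff: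
  fixes T :: "'a::complex_hilbert_space \<Rightarrow> 'a"
  assumes T: "bounded_clinear T" and W: "numerical_range T \<subseteq> cball 0 1"
    and l: "cmod l = 1" and d: "d > 0" "\<And>w. w \<in> numerical_range T \<Longrightarrow> d \<le> cmod (l - w)"
  shows "surj (\<lambda>x. l *\<^sub>C x - T x)"
proof -
  define P where "P r \<longleftrightarrow> surj (\<lambda>x. (complex_of_real r * l) *\<^sub>C x - T x)" for r :: real
  have lin: "T (x - y) = T x - T y" for x y
    using T unfolding bounded_clinear_def by (auto simp: linear_simps)
  have lower: "d * norm (x - y)
      \<le> norm (((complex_of_real r * l) *\<^sub>C x - T x) - ((complex_of_real r * l) *\<^sub>C y - T y))"
    if "1 \<le> r" for r x y
  proof -
    have "d * norm (x - y) \<le> norm ((complex_of_real r * l) *\<^sub>C (x - y) - T (x - y))"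
    proof (rule norm_scaleC_diff_ge[OF T])
      fix w assume w: "w \<in> numerical_range T"
      then have "cmod w \<le> 1"
        using W by auto
      then show "d \<le> cmod (complex_of_real r * l - w)"
        using cmod_diff_radial_mono[OF l _ that] d(2)[OF w] by (meson order_trans)
    qed
    then show ?thesis
      by (simp add: scaleC_diff_right lin algebra_simps)
  qed
  obtain K where K: "K > 0" "\<And>x. norm (T x) \<le> norm x * K"
    using T bounded_linear.pos_bounded unfolding bounded_clinear_def by blast
  \<comment> \<open>Here \<open>T\<close> is a perturbation, with Lipschitz constant
    \<open>K < r\<close>, of multiplication by a scalar of modulus \<open>r\<close>.\<close>
  have large: "P r" if "r > K" for r
    unfolding P_def
  proof (rule surj_diff_contraction)
    show "surj (\<lambda>x::'a. (complex_of_real r * l) *\<^sub>C x)"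
    proof (rule surjI)
      fix x :: 'a
      have "complex_of_real r * l \<noteq> 0"
        using that K(1) l by auto
      then show "(complex_of_real r * l) *\<^sub>C (inverse (complex_of_real r * l) *\<^sub>C x) = x"
        by (simp add: scaleC_scaleC scaleC_one right_inverse del: inverse_mult_distrib)
    qed
    show "r * norm (x - y) \<le> norm ((complex_of_real r * l) *\<^sub>C x - (complex_of_real r * l) *\<^sub>C y)"
      for x y :: 'a
      using that K(1) l by (simp add: scaleC_diff_right[symmetric] norm_scaleC norm_mult)
    show "norm (T x - T y) \<le> K * norm (x - y)" for x y
      using K(2)[of "x - y"] by (simp add: lin mult.commute)
  qed (use that K(1) in auto)
  \<comment> \<open>Moving inward by \<open>d / 2\<close> perturbs an operator with lower bound
    \<open>d\<close> by one of norm at most \<open>d / 2\<close>, so the contraction factor is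
    \<open>1 / 2\<close>.\<close>
  have step: "P r" if "P (r + d / 2)" "1 \<le> r" for r
  proof -
    have "surj (\<lambda>x. ((complex_of_real (r + d / 2) * l) *\<^sub>C x - T x)
        - (complex_of_real (d / 2) * l) *\<^sub>C x)"
    proof (rule surj_diff_contraction[where d = d and c = "d / 2"])
      show "surj (\<lambda>x. (complex_of_real (r + d / 2) * l) *\<^sub>C x - T x)"
        using that(1) unfolding P_def .
      show "norm ((complex_of_real (d / 2) * l) *\<^sub>C x - (complex_of_real (d / 2) * l) *\<^sub>C y)
          \<le> d / 2 * norm (x - y)" for x y :: 'a
        using d(1) l by (simp add: scaleC_diff_right[symmetric] norm_scaleC norm_mult norm_divide)
    qed (use d(1) that(2) in \<open>auto intro!: lower simp del: of_real_add\<close>)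
    moreover have "((complex_of_real (r + d / 2) * l) *\<^sub>C x - T x)
        - (complex_of_real (d / 2) * l) *\<^sub>C x = (complex_of_real r * l) *\<^sub>C x - T x" for x
    proof -
      have "complex_of_real r * l = complex_of_real (r + d / 2) * l - complex_of_real (d / 2) * l"
        by (simp add: algebra_simps)
      then show ?thesis
        by (simp only: scaleC_diff_left) simp
    qed
    ultimately show ?thesis
      unfolding P_def by (simp only:)
  qed
  \<comment> \<open>\<open>n\<close> counts inward steps from radius \<open>K + 1\<close>, where
    \<open>large\<close> applies; finitely many of them reach 1.\<close>
  have "P r" if "1 \<le> r" "K + 1 - real n * (d / 2) \<le> r" for r n
    using that
  proof (induction n arbitrary: r)
    case 0
    then show ?case
      by (intro large) simp
  next
    case (Suc n)
    have "P (r + d / 2)"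
      using Suc.prems d(1) by (intro Suc.IH) (auto simp: algebra_simps add_divide_distrib)
    then show ?case
      using step Suc.prems(1) by blast
  qed
  moreover obtain n where "K + 1 < real n * (d / 2)"
    using d(1) reals_Archimedean3[of "d / 2"] by (meson half_gt_zero)
  ultimately have "P 1"
    by (metis diff_less_0_iff_less less_imp_le order.refl order_less_trans zero_less_one)
  then show ?thesis
    by (simp add: P_def)
qed

text \<open>The lower bound \<open>d\<close> yields both injectivity and the norm estimate for the
  inverse. The nonnegativity of \<open>onorm\<close> serves to remove the absolute value in the
  final Landau estimate.\<close>

lemma scaleC_diff_invertible:
  fixes T :: "'a::complex_hilbert_space \<Rightarrow> 'a"
  assumes T: "bounded_clinear T" and W: "numerical_range T \<subseteq> cball 0 1"
    and l: "cmod l = 1" and d: "d > 0" "\<And>w. w \<in> numerical_range T \<Longrightarrow> d \<le> cmod (l - w)"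
  shows "l \<notin> spectrum T" and "onorm (resolvent l T) \<le> 1 / d" and "0 \<le> onorm (resolvent l T)"
proof -
  define A where "A = (\<lambda>x. l *\<^sub>C x - T x)"
  define S where "S = resolvent l T"
  have lin: "T (x + y) = T x + T y" "T (x - y) = T x - T y" "T (c *\<^sub>C x) = c *\<^sub>C T x" for x y c
    using T unfolding bounded_clinear_def by (auto simp: linear_simps(1,2))
  have A_lin: "A (x + y) = A x + A y" "A (x - y) = A x - A y" "A (c *\<^sub>C x) = c *\<^sub>C A x" for x y c
    by (simp_all add: A_def lin scaleC_add_right scaleC_diff_right scaleC_scaleC mult.commute)
  have lower: "d * norm x \<le> norm (A x)" for x
    unfolding A_def by (rule norm_scaleC_diff_ge[OF T d(2)])
  have "surj A"
    unfolding A_def by (rule surj_scaleC_diff[OF assms])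
  then have AS: "A (S x) = x" for x
    by (simp add: S_def resolvent_def A_def[symmetric] surj_f_inv_f)
  have "inj A"
  proof (rule injI)
    fix x y assume "A x = A y"
    then have "d * norm (x - y) \<le> 0"
      using lower[of "x - y"] by (simp add: A_lin)
    then show "x = y"
      using d(1) by (simp add: mult_le_0_iff)
  qed
  then have SA: "S (A x) = x" for x
    by (simp add: S_def resolvent_def A_def[symmetric])
  have S_add: "S (x + y) = S x + S y" for x y
    using SA[of "S x + S y"] by (simp add: A_lin AS)
  have S_scaleC: "S (c *\<^sub>C x) = c *\<^sub>C S x" for c x
    using SA[of "c *\<^sub>C S x"] by (simp add: A_lin AS)
  have S_norm: "norm (S x) \<le> 1 / d * norm x" for x
    using lower[of "S x"] d(1) by (simp add: AS field_simps)
  have "bounded_linear S"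
    by (rule bounded_linear_intro[where K = "1 / d"])
      (use S_norm in \<open>simp_all add: S_add scaleR_scaleC S_scaleC mult.commute\<close>)
  then show "0 \<le> onorm (resolvent l T)"
    unfolding S_def by (rule onorm_pos_le)
  have "bounded_clinear S"
    using \<open>bounded_linear S\<close> S_scaleC by (simp add: bounded_clinear_def)
  moreover have "S \<circ> A = id" "A \<circ> S = id"
    by (auto simp: SA AS)
  ultimately show "l \<notin> spectrum T"
    unfolding spectrum_def A_def by blast
  show "onorm (resolvent l T) \<le> 1 / d"
    unfolding S_def[symmetric] using S_norm d(1) by (intro onorm_bound) auto
qed

section \<open>Distance from the unit circle\<close>

text \<open>The imaginary part \<open>sin \<theta>\<close> suffices: by the mean value theorem
  \<open>sin t = t * cos z\<close> with \<open>0 < z < t \<le> 1 < pi / 3\<close>, and there the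
  cosine is at least \<open>1 / 2\<close>.\<close>

lemma abs_le_cmod_cis_diff_1:
  assumes "\<bar>\<theta>\<bar> \<le> 1"
  shows "\<bar>\<theta>\<bar> / 2 \<le> cmod (cis \<theta> - 1)"
proof -
  have pos: "t / 2 \<le> sin t" if "0 < t" "t \<le> 1" for t :: real
  proof -
    have "\<exists>z>0. z < t \<and> sin t - sin 0 = (t - 0) * cos z"
      using that by (intro MVT2) (auto intro!: derivative_eq_intros)
    then obtain z where z: "0 < z" "z < t" "sin t = t * cos z"
      by auto
    have "cos (pi / 3) \<le> cos z"
      using z that pi_gt3 by (intro cos_monotone_0_pi_le) auto
    then have "t * (1 / 2) \<le> t * cos z"
      using that by (intro mult_left_mono) (auto simp: cos_60)
    then show ?thesis
      by (simp add: z(3))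
  qed
  have "\<bar>\<theta>\<bar> / 2 \<le> \<bar>sin \<theta>\<bar>"
    using pos[of \<theta>] pos[of "- \<theta>"] assms by (cases "\<theta> = 0"; cases "\<theta> > 0") auto
  also have "\<dots> \<le> cmod (cis \<theta> - 1)"
    using abs_Im_le_cmod[of "cis \<theta> - 1"] by simp
  finally show ?thesis .
qed

text \<open>On the unit circle the left side of the estimate is constant in \<open>n\<close>, while
  the right side tends to 0.\<close>

lemma decay_imp_eq_1:
  assumes b: "\<And>n::nat. n \<ge> 1 \<Longrightarrow> cmod (z ^ n * (1 - z)) \<le> C * real n powr (- \<beta>)"
    and "\<beta> > 0" "cmod z = 1"
  shows "z = 1"
proof -
  have "(\<lambda>n. C * real n powr (- \<beta>)) \<longlonglongrightarrow> C * 0"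
    using assms(2)
    by (intro tendsto_mult tendsto_const tendsto_neg_powr filterlim_real_sequentially) auto
  moreover have "\<forall>\<^sub>F n in sequentially. cmod (1 - z) \<le> C * real n powr (- \<beta>)"
    using eventually_ge_at_top[of 1]
    by eventually_elim (use b assms(3) in \<open>simp add: norm_mult norm_power\<close>)
  ultimately have "cmod (1 - z) \<le> C * 0"
    by (intro tendsto_lowerbound[of _ _ sequentially]) auto
  then show ?thesis
    by simp
qed

text \<open>If \<open>z\<close> were closer than \<open>\<delta> = K \<bar>\<theta>\<bar> powr (1 / \<beta>)\<close>, then \<open>n \<approx> 1 / (2 \<delta>)\<close> would give
  \<open>\<bar>z\<bar>^n \<ge> 1 / 2\<close> by Bernoulli's inequality, contradicting the decay estimate.\<close>

lemma decay_imp_dist_cis_ge: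
  assumes "C > 0" "\<beta> \<in> {0<..1}"
  obtains K where "K > 0"
    "\<And>z (\<theta>::real). \<lbrakk>\<And>n::nat. n \<ge> 1 \<Longrightarrow> cmod (z ^ n * (1 - z)) \<le> C * real n powr (- \<beta>);
       \<theta> \<noteq> 0; \<bar>\<theta>\<bar> \<le> 1\<rbrakk> \<Longrightarrow> K * \<bar>\<theta>\<bar> powr (1 / \<beta>) \<le> cmod (cis \<theta> - z)"
proof
  \<comment> \<open>The first entry gives \<open>\<delta> \<le> \<bar>\<theta>\<bar> / 8\<close>;
    the second makes \<open>C * (4 * \<delta>) powr \<beta>\<close> at most
    \<open>\<bar>\<theta>\<bar> / 16\<close>, below the lower bound
    \<open>\<bar>\<theta>\<bar> / 8\<close> found for the same \<open>n\<close>.\<close>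
  define K where "K = min (1 / 8) ((1 / (16 * C)) powr (1 / \<beta>) / 4)"
  show "K > 0"
    using assms(1) by (simp add: K_def)
  fix z and \<theta> :: real
  assume b: "\<And>n::nat. n \<ge> 1 \<Longrightarrow> cmod (z ^ n * (1 - z)) \<le> C * real n powr (- \<beta>)"
    and \<theta>: "\<theta> \<noteq> 0" "\<bar>\<theta>\<bar> \<le> 1"
  define \<delta> where "\<delta> = K * \<bar>\<theta>\<bar> powr (1 / \<beta>)"
  show "K * \<bar>\<theta>\<bar> powr (1 / \<beta>) \<le> cmod (cis \<theta> - z)"
  proof (rule ccontr)
    assume "\<not> ?thesis"
    then have close: "cmod (cis \<theta> - z) < \<delta>"
      by (simp add: \<delta>_def)
    have \<delta>_pos: "\<delta> > 0"
      using \<open>K > 0\<close> \<theta> by (simp add: \<delta>_def)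
    have "\<bar>\<theta>\<bar> powr (1 / \<beta>) \<le> \<bar>\<theta>\<bar> powr 1"
      using assms(2) \<theta> by (intro powr_mono') auto
    then have "\<delta> \<le> 1 / 8 * \<bar>\<theta>\<bar>"
      unfolding \<delta>_def using \<open>K > 0\<close> \<theta> by (intro mult_mono) (auto simp: K_def)
    then have \<delta>_le: "\<delta> \<le> \<bar>\<theta>\<bar> / 8" "\<delta> \<le> 1 / 8"
      using \<theta> by auto
    define n where "n = nat \<lfloor>1 / (2 * \<delta>)\<rfloor>"
    have "1 / (2 * \<delta>) \<ge> 4"
      using \<delta>_pos \<delta>_le by (simp add: field_simps)
    \<comment> \<open>As \<open>1 / (2 * \<delta>)\<close> is at least 4, rounding down loses less
      than half of it.\<close>
    then have n: "n \<ge> 1" "real n \<le> 1 / (2 * \<delta>)" "1 / (4 * \<delta>) \<le> real n"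
      unfolding n_def by linarith+
    have n\<delta>: "real n * \<delta> \<le> 1 / 2" "1 \<le> 4 * \<delta> * real n"
      using n \<delta>_pos by (simp_all add: field_simps)
    have "\<bar>\<theta>\<bar> / 2 \<le> cmod (cis \<theta> - z) + cmod (z - 1)"
      using abs_le_cmod_cis_diff_1[OF \<theta>(2)] norm_triangle_ineq[of "cis \<theta> - z" "z - 1"] by simp
    then have z1: "\<bar>\<theta>\<bar> / 4 \<le> cmod (1 - z)"
      using close \<delta>_le by (simp add: norm_minus_commute)
    have "1 \<le> cmod (cis \<theta> - z) + cmod z"
      using norm_triangle_ineq[of "cis \<theta> - z" z] by simp
    then have z0: "1 - \<delta> \<le> cmod z"
      using close by simp
    have "1 / 2 \<le> 1 + real n * (- \<delta>)"
      using n\<delta>(1) by simp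
    also have "\<dots> \<le> (1 + - \<delta>) ^ n"
      using \<delta>_le by (intro Bernoulli_inequality) simp
    also have "\<dots> \<le> cmod z ^ n"
      using z0 \<delta>_le by (intro power_mono) auto
    finally have "1 / 2 * (\<bar>\<theta>\<bar> / 4) \<le> cmod z ^ n * cmod (1 - z)"
      using z1 by (intro mult_mono) auto
    also have "\<dots> \<le> C * real n powr (- \<beta>)"
      using b[OF n(1)] by (simp add: norm_mult norm_power)
    \<comment> \<open>The exponent is negative, so the lower bound on \<open>n\<close> is the one
      that enters.\<close>
    also have "\<dots> \<le> C * (1 / (4 * \<delta>)) powr (- \<beta>)"
      using assms n \<delta>_pos by (intro mult_left_mono powr_mono2') auto
    also have "\<dots> = C * (4 * \<delta>) powr \<beta>"
      using \<delta>_pos by (simp add: powr_minus powr_divide field_simps)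
    also have "\<dots> \<le> C * ((1 / (16 * C)) powr (1 / \<beta>) * \<bar>\<theta>\<bar> powr (1 / \<beta>)) powr \<beta>"
    proof (intro mult_left_mono powr_mono2)
      show "4 * \<delta> \<le> (1 / (16 * C)) powr (1 / \<beta>) * \<bar>\<theta>\<bar> powr (1 / \<beta>)"
        unfolding \<delta>_def mult.assoc[symmetric] by (intro mult_right_mono) (auto simp: K_def)
    qed (use assms \<delta>_pos in auto)
    also have "\<dots> = \<bar>\<theta>\<bar> / 16"
      using assms \<theta> by (simp add: powr_mult powr_powr)
    finally show False
      using \<theta> by simp
  qed
qed

section \<open>Power-boundedness, peripheral spectrum and resolvent growth from the decay
  hypothesis\<close>

theorem proposition3p4:
  fixes T :: "'a::complex_hilbert_space \<Rightarrow> 'a"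
    and \<Omega> :: "complex set"
    and C \<beta> :: real
  assumes "bounded_clinear T"
    and "\<Omega> = closure (numerical_range T)"
    and "\<Omega> \<subseteq> cball 0 1"
    and "C > 0"
    and "\<beta> \<in> {0<..1}"
    and "\<And>n::nat. n \<ge> 1 \<Longrightarrow>
           (SUP z\<in>\<Omega>. ereal (cmod (z ^ n * (1 - z)))) \<le> ereal (C * real n powr (- \<beta>))"
  shows "power_bounded T
    \<and> spectrum T \<inter> sphere 0 1 \<subseteq> {1}
    \<and> (\<lambda>\<theta>::real. onorm (resolvent (cis \<theta>) T)) \<in> O[at 0](\<lambda>\<theta>. \<bar>\<theta>\<bar> powr (- 1 / \<beta>))"
proof (intro conjI)
  have sub: "numerical_range T \<subseteq> \<Omega>"
    using assms(2) closure_subset by blast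
  then have W: "numerical_range T \<subseteq> cball 0 1"
    using assms(3) by blast
  have b: "cmod (z ^ n * (1 - z)) \<le> C * real n powr (- \<beta>)" if "z \<in> \<Omega>" "n \<ge> 1" for z n
    using assms(6)[OF that(2)] that(1) by (auto simp: SUP_le_iff)
  show "power_bounded T"
    using assms(1) W by (rule power_bounded_of_numerical_range)
  show "spectrum T \<inter> sphere 0 1 \<subseteq> {1}"
  proof
    fix l assume l: "l \<in> spectrum T \<inter> sphere 0 1"
    show "l \<in> {1}"
    proof (rule ccontr)
      assume "l \<notin> {1}"
      then have "l \<notin> \<Omega>"
        using decay_imp_eq_1[of l C \<beta>] b l assms(5) by auto
      \<comment> \<open>\<open>\<Omega>\<close> is closed, so a point outside it has positive
        distance from it.\<close>
      then obtain d where d: "d > 0" "\<forall>w\<in>\<Omega>. d \<le> dist l w"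
        using separate_point_closed[of \<Omega> l] assms(2) by auto
      have "l \<notin> spectrum T"
        using assms(1) W
      proof (rule scaleC_diff_invertible(1))
        show "d \<le> cmod (l - w)" if "w \<in> numerical_range T" for w
          using d(2) sub that by (auto simp: dist_norm)
      qed (use l d in auto)
      then show False
        using l by blast
    qed
  qed
  obtain K where K: "K > 0"
    "\<And>z (\<theta>::real). \<lbrakk>\<And>n::nat. n \<ge> 1 \<Longrightarrow> cmod (z ^ n * (1 - z)) \<le> C * real n powr (- \<beta>);
       \<theta> \<noteq> 0; \<bar>\<theta>\<bar> \<le> 1\<rbrakk> \<Longrightarrow> K * \<bar>\<theta>\<bar> powr (1 / \<beta>) \<le> cmod (cis \<theta> - z)"
    using decay_imp_dist_cis_ge[OF assms(4,5)] by blast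
  have bound: "norm (onorm (resolvent (cis \<theta>) T)) \<le> 1 / K * norm (\<bar>\<theta>\<bar> powr (- 1 / \<beta>))"
    if "\<theta> \<noteq> 0" "\<bar>\<theta>\<bar> \<le> 1" for \<theta> :: real
  proof -
    have d: "K * \<bar>\<theta>\<bar> powr (1 / \<beta>) > 0"
      using K(1) that by simp
    have "K * \<bar>\<theta>\<bar> powr (1 / \<beta>) \<le> cmod (cis \<theta> - w)" if "w \<in> numerical_range T" for w
      using sub that \<open>\<theta> \<noteq> 0\<close> \<open>\<bar>\<theta>\<bar> \<le> 1\<close> by (intro K(2) b) auto
    note inv = scaleC_diff_invertible(2,3)[OF assms(1) W norm_cis d this]
    have "1 / (K * \<bar>\<theta>\<bar> powr (1 / \<beta>)) = 1 / K * \<bar>\<theta>\<bar> powr (- 1 / \<beta>)"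
      using that by (simp add: powr_minus field_simps)
    then show ?thesis
      using inv by simp
  qed
  show "(\<lambda>\<theta>::real. onorm (resolvent (cis \<theta>) T)) \<in> O[at 0](\<lambda>\<theta>. \<bar>\<theta>\<bar> powr (- 1 / \<beta>))"
  proof (rule bigoI)
    show "\<forall>\<^sub>F \<theta> in at 0. norm (onorm (resolvent (cis \<theta>) T)) \<le> 1 / K * norm (\<bar>\<theta>\<bar> powr (- 1 / \<beta>))"
      unfolding eventually_at dist_real_def
      by (intro exI[of _ 1] conjI ballI impI bound) auto
  qed
qed

end
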